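(* Let $X$ and $Y$ be random variables with cdfs $F_X$ and $F_Y$, and let $A_0=\{u\in(0,1): F_X^{\leftarrow}(u)>F_Y^{\leftarrow}(u)\}$. Let $s\in\mathbb{N}$ and let $\boldsymbol{w}=(w_1,\ldots,w_s)$ with $w_i>0$ for every $i$ and $\sum_{i=1}^s w_i=1$. For every $\alpha>0$ let $0<r_1<r_2<\cdots<r_s<\alpha+1$, where the $r_i$ may depend on $\alpha$, and suppose that the limits $\lambda_i=\lim_{\alpha\to\infty}\frac{r_i}{\alpha+1}$ exist and satisfy $\lambda_1<\lambda_2<\cdots<\lambda_s$. For every $\alpha>0$ let $X_{\boldsymbol{w},\boldsymbol{r},\alpha}$ and $Y_{\boldsymbol{w},\boldsymbol{r},\alpha}$ be random variables with respective cdfs $$F_{X_{\boldsymbol{w},\boldsymbol{r},\alpha}}(x)=\sum_{i=1}^s w_i\,\phi_{r_i,\alpha}(F_X(x)),\qquad F_{Y_{\boldsymbol{w},\boldsymbol{r},\alpha}}(x)=\sum_{i=1}^s w_i\,\phi_{r_i,\alpha}(F_Y(x)),\qquad x\in\mathbb{R}.$$ Assume that $$\min_{i\in\{1,2,\ldots,s\}}\mathrm{dist}(\lambda_i,A_0)>0.$$ Then $X_{\boldsymbol{w},\boldsymbol{r},\alpha}\leq_{L_1\text{-ast}} Y_{\boldsymbol{w},\boldsymbol{r},\alpha}$, as $\alpha\to\infty$, if $\max\{E|X|,E|Y|\}<\infty$; and $X_{\boldsymbol{w},\boldsymbol{r},\alpha}\leq_{\mathcal{W}_2\text{-ast}} Y_{\boldsymbol{w},\boldsymbol{r},\alpha}$,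 as $\alpha\to\infty$, if $\max\{E(X^2),E(Y^2)\}<\infty$.
   Context: For a cdf $F$, $F^{\leftarrow}(u)=\inf\{x\in\mathbb{R}: F(x)\ge u\}$ for $u\in(0,1)$; $\mathrm{dist}(x,S)=\inf_{y\in S}|x-y|$ (with $\inf\emptyset=+\infty$). For $\alpha>0$ and $0<r<\alpha+1$, $\phi_{r,\alpha}(u)=\frac{1}{B(r,\alpha-r+1)}\int_0^u v^{r-1}(1-v)^{\alpha-r}\,dv$, $u\in[0,1]$, where $B$ is the Beta function. The $r$th order statistic from a sample of (possibly non-integral) size $\alpha$ from a distribution with cdf $F$ is by definition a random variable with cdf $\phi_{r,\alpha}(F(x))$; thus $X_{\boldsymbol{w},\boldsymbol{r},\alpha}$ and $Y_{\boldsymbol{w},\boldsymbol{r},\alpha}$ are mixtures of order statistics. For families of random variables $U_\alpha$, $V_\alpha$ ($\alpha>0$) with cdfs $F_{U_\alpha},F_{V_\alpha}$: $U_\alpha\leq_{L_1\text{-ast}}V_\alpha$, as $\alpha\to\infty$, means $\lim_{\alpha\to\infty}\int_{\{x\in\mathbb{R}:F_{U_\alpha}(x)<F_{V_\alpha}(x)\}}|F_{U_\alpha}(x)-F_{V_\alpha}(x)|\,dx=0$; $U_\alpha\leq_{\mathcal{W}_2\text{-ast}}V_\alpha$, as $\alpha\to\infty$, means $\lim_{\alpha\to\infty}\int_{\{u\in(0,1):F_{U_\alpha}^{\leftarrow}(u)>F_{V_\alpha}^{\leftarrow}(u)\}}(F_{U_\alpha}^{\leftarrow}(u)-F_{V_\alpha}^{\leftarrow}(u))^2\,du=0$.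 *)

theory Defs
  imports "HOL-Probability.Probability"
begin

definition rv_cdf :: "'a measure \<Rightarrow> ('a \<Rightarrow> real) \<Rightarrow> real \<Rightarrow> real" where
  "rv_cdf M X = cdf (distr M borel X)"

text \<open>Only meaningful for \<open>0 < u < 1\<close>, where the set is nonempty and bounded below
  if \<open>F\<close> is the cdf of a probability distribution.\<close>

definition quantile :: "(real \<Rightarrow> real) \<Rightarrow> real \<Rightarrow> real" where
  "quantile F u = Inf {x. u \<le> F x}"

text \<open>\<open>infdist\<close> and \<open>setdist\<close> assign distance 0 to the empty set.  The extended reals
  give \<open>\<infinity>\<close> instead, which is the convention needed here.\<close>

definition ereal_dist :: "real \<Rightarrow> real set \<Rightarrow> ereal" where
  "ereal_dist x S = (INF y\<in>S. ereal \<bar>x - y\<bar>)"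

text \<open>For \<open>0 < r < \<alpha> + 1\<close>, the cdf on the unit interval of the Beta distribution with parameters
  \<open>r\<close> and \<open>\<alpha> - r + 1\<close>.  At the endpoints 0 and 1 \<open>powr\<close> has base 0 and the integrand is 0 by
  convention, which does not affect the integral.\<close>

definition beta_phi :: "real \<Rightarrow> real \<Rightarrow> real \<Rightarrow> real" where
  "beta_phi r \<alpha> u =
     1 / Beta r (\<alpha> - r + 1) * (LINT v:{0..u}|lborel. v powr (r - 1) * (1 - v) powr (\<alpha> - r))"

text \<open>The asymptotic stochastic orders compare families \<open>U \<alpha>\<close>, \<open>V \<alpha>\<close> of random variables; each
  member may live on its own probability space (\<open>P \<alpha>\<close> and \<open>Q \<alpha>\<close>, respectively).  The integrals
  take values in \<open>[0, \<infinity>]\<close>, so that a divergent integral counts as \<open>\<infinity>\<close> and not as 0.\<close>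

definition L1_ast_le ::
  "(real \<Rightarrow> 'a measure) \<Rightarrow> (real \<Rightarrow> 'a \<Rightarrow> real) \<Rightarrow> (real \<Rightarrow> 'b measure) \<Rightarrow> (real \<Rightarrow> 'b \<Rightarrow> real) \<Rightarrow> bool"
where
  "L1_ast_le P U Q V \<longleftrightarrow>
     ((\<lambda>\<alpha>. \<integral>\<^sup>+x\<in>{x. rv_cdf (P \<alpha>) (U \<alpha>) x < rv_cdf (Q \<alpha>) (V \<alpha>) x}.
             ennreal \<bar>rv_cdf (P \<alpha>) (U \<alpha>) x - rv_cdf (Q \<alpha>) (V \<alpha>) x\<bar> \<partial>lborel) \<longlongrightarrow> 0) at_top"

definition W2_ast_le ::
  "(real \<Rightarrow> 'a measure) \<Rightarrow> (real \<Rightarrow> 'a \<Rightarrow> real) \<Rightarrow> (real \<Rightarrow> 'b measure) \<Rightarrow> (real \<Rightarrow> 'b \<Rightarrow> real) \<Rightarrow> bool"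
where
  "W2_ast_le P U Q V \<longleftrightarrow>
     ((\<lambda>\<alpha>. \<integral>\<^sup>+u\<in>{u\<in>{0<..<1}. quantile (rv_cdf (P \<alpha>) (U \<alpha>)) u > quantile (rv_cdf (Q \<alpha>) (V \<alpha>)) u}.
             ennreal ((quantile (rv_cdf (P \<alpha>) (U \<alpha>)) u - quantile (rv_cdf (Q \<alpha>) (V \<alpha>)) u)\<^sup>2) \<partial>lborel)
        \<longlongrightarrow> 0) at_top"

end

theory Submission
  imports Defs
begin

text \<open>
  Write \<open>F\<close>, \<open>G\<close> for the cdfs of \<open>X\<close>, \<open>Y\<close>, and \<open>\<nu>\<^sub>\<alpha>\<close> for the mixture with weights \<open>w\<close> of the Beta
  distributions with parameters \<open>r\<^sub>i\<close> and \<open>\<alpha> - r\<^sub>i + 1\<close>. The cdf of \<open>\<nu>\<^sub>\<alpha>\<close> is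
  \<open>H\<^sub>\<alpha> = (\<Sum>i. w\<^sub>i \<phi>(r\<^sub>i, \<alpha>))\<close>, so the two mixtures of order statistics have the cdfs \<open>H\<^sub>\<alpha> \<circ> F\<close> and
  \<open>H\<^sub>\<alpha> \<circ> G\<close>, and at almost every level their quantile functions are those of \<open>F\<close> and \<open>G\<close> composed
  with that of \<open>H\<^sub>\<alpha>\<close>.

  Both integrals in the conclusion are thereby bounded by integrals with respect to \<open>\<nu>\<^sub>\<alpha>\<close> over the
  set \<open>A\<^sub>0\<close> of levels where \<open>F\<close> has the larger quantile. For the squared quantile distance this is the
  substitution \<open>p = H\<^sub>\<alpha>\<^sup>-\<^sup>1(u)\<close> (\<open>W2_excess_composed_le\<close>). For the distance of the cdfs,
  \<open>H\<^sub>\<alpha>(G x) - H\<^sub>\<alpha>(F x)\<close> is the \<open>\<nu>\<^sub>\<alpha>\<close>-measure of the interval \<open>(F x, G x]\<close>, and \<open>p\<close> lies in it iff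
  \<open>x\<close> lies between the \<open>p\<close>-quantile of \<open>G\<close> and that of \<open>F\<close>; exchanging the integrals gives the
  integral over \<open>A\<^sub>0\<close> of the difference of the quantiles (\<open>L1_excess_composed_le\<close>).

  The moment hypotheses make the same integrals with respect to Lebesgue measure finite, because
  \<open>\<integral>\<bar>F\<^sup>-\<^sup>1(p)\<bar>\<^sup>k dp\<close> is the \<open>k\<close>-th absolute moment of \<open>X\<close> (\<open>nn_integral_quantile_excess\<close>). It remains
  that the density of \<open>\<nu>\<^sub>\<alpha>\<close> tends to 0 uniformly on \<open>A\<^sub>0\<close>. The Beta distributions concentrate at
  the \<open>\<lambda>\<^sub>i\<close>, which have positive distance from \<open>A\<^sub>0\<close>. Their densities are monotone away
  from the mode, so a large value at a point far from \<open>\<lambda>\<^sub>i\<close> would persist on an interval that is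
  still far from \<open>\<lambda>\<^sub>i\<close>, and force a second moment about \<open>\<lambda>\<^sub>i\<close> that is bounded below
  (\<open>beta_density_le_sq_dev\<close>). That second moment is explicit and tends to 0. The argument is
  insensitive to whether \<open>\<lambda>\<^sub>i\<close> is 0 or 1, where the density itself may be unbounded.
\<close>

section \<open>Beta densities away from their centre\<close>

definition beta_density :: "real \<Rightarrow> real \<Rightarrow> real \<Rightarrow> real" where
  "beta_density a b v =
     indicator {0<..<1} v * (v powr (a - 1) * (1 - v) powr (b - 1)) / Beta a b"

lemma Beta_real_pos: "0 < Beta a b" if "0 < a" "0 < b" for a b :: real
  using that by (simp add: Beta_def Gamma_real_pos)

lemma beta_density_nonneg: "0 \<le> beta_density a b v" if "0 < a" "0 < b"
  using Beta_real_pos[OF that] by (simp add: beta_density_def)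

lemma borel_measurable_beta_density [measurable]: "beta_density a b \<in> borel_measurable borel"
  unfolding beta_density_def[abs_def] by measurable

lemma beta_density_reflect: "beta_density a b (1 - v) = beta_density b a v"
  by (auto simp: beta_density_def Beta_commute[of a b] indicator_def)

lemma has_bochner_integral_beta_density:
  assumes "0 < a" "0 < b"
  shows "has_bochner_integral lborel (beta_density a b) 1"
proof -
  note B = Beta_real_pos[OF assms]
  have "((\<lambda>v. v powr (a - 1) * (1 - v) powr (b - 1)) has_integral Beta a b) {0<..<1}"
    using has_integral_Beta_real[OF assms] by (simp add: has_integral_Icc_iff_Ioo)
  from has_integral_divide[OF this, of "Beta a b"]
  have "((\<lambda>v. v powr (a - 1) * (1 - v) powr (b - 1) / Beta a b) has_integral 1) {0<..<1}"
    using B by simp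
  from nn_integral_has_integral_lebesgue[OF _ this]
  have "(\<integral>\<^sup>+v. ennreal (beta_density a b v) \<partial>lborel) = ennreal 1"
    using B by (simp add: beta_density_def)
  then show ?thesis
    by (intro has_bochner_integral_nn_integral) (auto simp: beta_density_nonneg[OF assms])
qed

text \<open>The source of all moments: multiplication by the identity raises the first parameter by one.\<close>
lemma beta_density_times_id:
  assumes "0 < a" "0 < b"
  shows "v * beta_density a b v = a / (a + b) * beta_density (a + 1) b v"
proof (cases "v \<in> {0<..<1}")
  case True
  have "(a + b) * Beta (a + 1) b = a * Beta a b"
    using assms by (intro Beta_plus1_left) (auto elim!: nonpos_Ints_cases)
  then have eq: "Beta (a + 1) b = a / (a + b) * Beta a b"
    using assms by (simp add: eq_divide_eq mult.commute)
  have "v powr a = v * v powr (a - 1)"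
    using True by (simp add: powr_mult_base)
  then show ?thesis
    using True assms Beta_real_pos[OF assms] unfolding beta_density_def eq by (simp add: mult_ac)
qed (simp add: beta_density_def)

text \<open>The second moment about \<open>c\<close> of the Beta distribution with parameters \<open>a\<close> and \<open>b\<close>.\<close>
definition beta_sq_dev :: "real \<Rightarrow> real \<Rightarrow> real \<Rightarrow> real" where
  "beta_sq_dev a b c = a / (a + b) * ((a + 1) / (a + b + 1)) - 2 * c * (a / (a + b)) + c\<^sup>2"

lemma has_bochner_integral_beta_sq_dev:
  assumes "0 < a" "0 < b"
  shows "has_bochner_integral lborel (\<lambda>v. (v - c)\<^sup>2 * beta_density a b v) (beta_sq_dev a b c)"
proof -
  have m1: "v * beta_density a b v = a / (a + b) * beta_density (a + 1) b v" for v
    using beta_density_times_id[OF assms] .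
  have m2: "v * beta_density (a + 1) b v = (a + 1) / (a + b + 1) * beta_density (a + 1 + 1) b v" for v
    using beta_density_times_id[of "a + 1" b] assms by (simp add: add_ac)
  have eq: "(v - c)\<^sup>2 * beta_density a b v =
      (a / (a + b) * ((a + 1) / (a + b + 1))) * beta_density (a + 1 + 1) b v
      - (2 * c * (a / (a + b))) * beta_density (a + 1) b v + c\<^sup>2 * beta_density a b v" for v
  proof -
    have "(v - c)\<^sup>2 * beta_density a b v =
        v * (v * beta_density a b v) - 2 * c * (v * beta_density a b v) + c\<^sup>2 * beta_density a b v"
      by (simp add: power2_eq_square algebra_simps)
    also have "v * (v * beta_density a b v) = a / (a + b) * (v * beta_density (a + 1) b v)"
      by (simp add: m1)
    finally show ?thesis
      by (simp add: m1 m2)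
  qed
  have scaled: "has_bochner_integral lborel (\<lambda>v. k * beta_density a' b v) k" if "0 < a'" for k a'
    using has_bochner_integral_mult_right[OF has_bochner_integral_beta_density[OF that \<open>0 < b\<close>], of k]
    by simp
  show ?thesis
    unfolding eq beta_sq_dev_def
    using assms by (intro has_bochner_integral_add has_bochner_integral_diff scaled) auto
qed

text \<open>The logarithm of the density has derivative \<open>(a - 1) / x - (b - 1) / (1 - x)\<close>, which is
  nonpositive iff \<open>a - 1 \<le> (a + b - 2) x\<close>. If \<open>a + b \<ge> 2\<close>, this persists to the right of \<open>u\<close>.\<close>
lemma beta_density_decreasing:
  assumes ab: "0 < a" "0 < b" and "2 \<le> a + b"
    and uv: "0 < u" "u \<le> v" "v < 1"
    and mode: "a - 1 \<le> (a + b - 2) * u"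
  shows "beta_density a b v \<le> beta_density a b u"
proof -
  define g where "g x = (a - 1) * ln x + (b - 1) * ln (1 - x)" for x
  have "g v \<le> g u"
  proof (rule DERIV_nonpos_imp_nonincreasing[OF \<open>u \<le> v\<close>])
    fix x assume x: "u \<le> x" "x \<le> v"
    with uv have x01: "0 < x" "x < 1"
      by auto
    have "(a + b - 2) * u \<le> (a + b - 2) * x"
      using x \<open>2 \<le> a + b\<close> by (intro mult_left_mono) auto
    with mode have "(a - 1) * (1 - x) \<le> (b - 1) * x"
      by (simp add: algebra_simps)
    then have "(a - 1) / x - (b - 1) / (1 - x) \<le> 0"
      using x01 by (simp add: field_simps)
    moreover have "(g has_real_derivative ((a - 1) / x - (b - 1) / (1 - x))) (at x)"
      unfolding g_def using x01 by (auto intro!: derivative_eq_intros)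
    ultimately show "\<exists>y. (g has_real_derivative y) (at x) \<and> y \<le> 0"
      by blast
  qed
  then have "exp (g v) / Beta a b \<le> exp (g u) / Beta a b"
    using Beta_real_pos[OF ab] by (intro divide_right_mono) auto
  moreover have "beta_density a b x = exp (g x) / Beta a b" if "0 < x" "x < 1" for x
    using that by (simp add: beta_density_def g_def powr_def exp_add)
  ultimately show ?thesis
    using uv by simp
qed

text \<open>Chebyshev's argument: on the interval of length \<open>\<eta> / 2\<close> to the left of \<open>p\<close>, the density is at
  least its value at \<open>p\<close> and the squared distance to \<open>c\<close> is at least \<open>\<eta>\<^sup>2 / 4\<close>, so this interval
  alone contributes \<open>\<eta>\<^sup>3 / 8\<close> times the value at \<open>p\<close> to the second moment about \<open>c\<close>.\<close>
lemma beta_density_le_sq_dev: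
  assumes ab: "0 < a" "0 < b" and ab2: "2 \<le> a + b"
    and c: "0 \<le> c" "0 < \<eta>" and p: "c + \<eta> \<le> p" "p < 1"
    and mode: "a - 1 \<le> (a + b - 2) * (c + \<eta> / 2)"
  shows "beta_density a b p \<le> 8 / \<eta> ^ 3 * beta_sq_dev a b c"
proof -
  let ?k = "beta_density a b p * (\<eta> / 2)\<^sup>2"
  have "has_bochner_integral lborel (indicator {p - \<eta> / 2..p}) (\<eta> / 2)"
    using has_bochner_integral_real_indicator[of "{p - \<eta> / 2..p}" lborel] c by simp
  then have "has_bochner_integral lborel (\<lambda>v. ?k * indicator {p - \<eta> / 2..p} v) (?k * (\<eta> / 2))"
    by (rule has_bochner_integral_mult_right)
  moreover have "?k * indicator {p - \<eta> / 2..p} v \<le> (v - c)\<^sup>2 * beta_density a b v" for v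
  proof (cases "v \<in> {p - \<eta> / 2..p}")
    case True
    have "(a + b - 2) * (c + \<eta> / 2) \<le> (a + b - 2) * v"
      using True p ab2 by (intro mult_left_mono) auto
    then have "beta_density a b p \<le> beta_density a b v"
      using True p c mode by (intro beta_density_decreasing ab ab2) auto
    moreover have "(\<eta> / 2)\<^sup>2 \<le> (v - c)\<^sup>2"
      using True p c by (intro power_mono) auto
    ultimately have "beta_density a b p * (\<eta> / 2)\<^sup>2 \<le> beta_density a b v * (v - c)\<^sup>2"
      by (intro mult_mono) (auto simp: beta_density_nonneg ab)
    with True show ?thesis
      by (simp add: mult_ac)
  qed (auto simp: beta_density_nonneg ab)
  ultimately have "?k * (\<eta> / 2) \<le> beta_sq_dev a b c"
    using has_bochner_integral_beta_sq_dev[OF ab, of c]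
    by (metis (no_types, lifting) has_bochner_integral_iff integral_mono)
  then show ?thesis
    using c by (simp add: field_simps power2_eq_square power3_eq_cube)
qed

text \<open>The means tend to \<open>c\<close> and the variances to 0.\<close>
lemma beta_sq_dev_tendsto_0:
  assumes lim: "((\<lambda>x. a x / (a x + b x)) \<longlongrightarrow> c) F" and inf: "filterlim (\<lambda>x. a x + b x) at_top F"
  shows "((\<lambda>x. beta_sq_dev (a x) (b x) c) \<longlongrightarrow> 0) F"
proof -
  have inv: "((\<lambda>x. 1 / (a x + b x)) \<longlongrightarrow> 0) F"
    by (rule tendsto_divide_0[OF tendsto_const]) (rule filterlim_at_top_imp_at_infinity[OF inf])
  \<comment> \<open>\<open>(a + 1) / (a + b + 1)\<close> has the same limit as \<open>a / (a + b)\<close>.\<close>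
  have "((\<lambda>x. (a x / (a x + b x) + 1 / (a x + b x)) / (1 + 1 / (a x + b x)))
      \<longlongrightarrow> (c + 0) / (1 + 0)) F"
    by (intro tendsto_intros lim inv) auto
  moreover have "\<forall>\<^sub>F x in F. (a x / (a x + b x) + 1 / (a x + b x)) / (1 + 1 / (a x + b x)) =
      (a x + 1) / (a x + b x + 1)"
    using filterlim_at_top_dense[THEN iffD1, OF inf, rule_format, of 0]
  proof eventually_elim
    case (elim x)
    then have "1 + 1 / (a x + b x) = (a x + b x + 1) / (a x + b x)"
      by (simp add: add_divide_distrib)
    with elim show ?case
      by (simp flip: add_divide_distrib)
  qed
  ultimately have "((\<lambda>x. (a x + 1) / (a x + b x + 1)) \<longlongrightarrow> c) F"
    by (simp add: tendsto_cong)
  then have "((\<lambda>x. beta_sq_dev (a x) (b x) c) \<longlongrightarrow> c * c - 2 * c * c + c\<^sup>2) F"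
    unfolding beta_sq_dev_def by (intro tendsto_intros lim)
  then show ?thesis
    by (simp add: power2_eq_square)
qed

lemma beta_density_small_above:
  assumes pos: "\<forall>\<^sub>F x in F. 0 < a x \<and> 0 < b x"
    and lim: "((\<lambda>x. a x / (a x + b x)) \<longlongrightarrow> c) F" and inf: "filterlim (\<lambda>x. a x + b x) at_top F"
    and c: "0 \<le> c" and "0 < \<eta>" "0 < \<epsilon>"
  shows "\<forall>\<^sub>F x in F. \<forall>p. c + \<eta> \<le> p \<and> p < 1 \<longrightarrow> beta_density (a x) (b x) p < \<epsilon>"
proof -
  have inv: "((\<lambda>x. 1 / (a x + b x)) \<longlongrightarrow> 0) F"
    by (rule tendsto_divide_0[OF tendsto_const]) (rule filterlim_at_top_imp_at_infinity[OF inf])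
  \<comment> \<open>The condition \<open>a - 1 \<le> (a + b - 2) (c + \<eta> / 2)\<close>, divided by \<open>a + b\<close>, tends to
    \<open>c \<le> c + \<eta> / 2\<close>.\<close>
  have "((\<lambda>x. a x / (a x + b x) - 1 / (a x + b x) - (1 - 2 * (1 / (a x + b x))) * (c + \<eta> / 2))
      \<longlongrightarrow> c - 0 - (1 - 2 * 0) * (c + \<eta> / 2)) F"
    by (intro tendsto_intros lim inv)
  then have mode: "\<forall>\<^sub>F x in F. a x / (a x + b x) - 1 / (a x + b x)
      - (1 - 2 * (1 / (a x + b x))) * (c + \<eta> / 2) < 0"
    using \<open>0 < \<eta>\<close> by (intro order_tendstoD) auto
  have "((\<lambda>x. 8 / \<eta> ^ 3 * beta_sq_dev (a x) (b x) c) \<longlongrightarrow> 8 / \<eta> ^ 3 * 0) F"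
    by (intro tendsto_intros beta_sq_dev_tendsto_0 lim inf)
  then have dev: "\<forall>\<^sub>F x in F. 8 / \<eta> ^ 3 * beta_sq_dev (a x) (b x) c < \<epsilon>"
    using \<open>0 < \<epsilon>\<close> by (intro order_tendstoD) auto
  have "\<forall>\<^sub>F x in F. 2 \<le> a x + b x"
    using inf by (simp add: filterlim_at_top)
  with pos mode dev show ?thesis
  proof eventually_elim
    case (elim x)
    let ?n = "a x + b x"
    have "?n * (a x / ?n - 1 / ?n - (1 - 2 * (1 / ?n)) * (c + \<eta> / 2)) \<le> 0"
      using elim by (intro mult_nonneg_nonpos) auto
    also have "?n * (a x / ?n - 1 / ?n - (1 - 2 * (1 / ?n)) * (c + \<eta> / 2)) =
        (a x - 1) - (?n - 2) * (c + \<eta> / 2)"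
    proof -
      have "n * (u / n - 1 / n - (1 - 2 * (1 / n)) * d) = (u - 1) - (n - 2) * d"
        if "2 \<le> n" for n u d :: real
        using that by (simp add: field_simps)
      from this[of ?n "a x" "c + \<eta> / 2"] elim show ?thesis
        by simp
    qed
    finally have "a x - 1 \<le> (?n - 2) * (c + \<eta> / 2)"
      by simp
    with elim c \<open>0 < \<eta>\<close> show ?case
      by (auto intro: beta_density_le_sq_dev le_less_trans)
  qed
qed

text \<open>The points to the left of \<open>c\<close> are reduced to those to the right by the reflection \<open>p \<mapsto> 1 - p\<close>,
  which exchanges the parameters.\<close>
lemma beta_density_small_away:
  assumes pos: "\<forall>\<^sub>F x in F. 0 < a x \<and> 0 < b x" and "F \<noteq> bot"
    and lim: "((\<lambda>x. a x / (a x + b x)) \<longlongrightarrow> c) F" and inf: "filterlim (\<lambda>x. a x + b x) at_top F"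
    and "0 < \<eta>" "0 < \<epsilon>"
  shows "\<forall>\<^sub>F x in F. \<forall>p\<in>{0<..<1}. \<eta> \<le> \<bar>c - p\<bar> \<longrightarrow> beta_density (a x) (b x) p < \<epsilon>"
proof -
  have "\<forall>\<^sub>F x in F. a x / (a x + b x) \<in> {0..1}"
    using pos by eventually_elim auto
  from Lim_in_closed_set[OF _ this \<open>F \<noteq> bot\<close> lim] have c: "0 \<le> c" "c \<le> 1"
    by auto
  have "\<forall>\<^sub>F x in F. 1 - a x / (a x + b x) = b x / (b x + a x)"
    using pos by eventually_elim (simp add: field_simps)
  moreover have "((\<lambda>x. 1 - a x / (a x + b x)) \<longlongrightarrow> 1 - c) F"
    by (intro tendsto_intros lim)
  ultimately have lim': "((\<lambda>x. b x / (b x + a x)) \<longlongrightarrow> 1 - c) F"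
    by (rule Lim_transform_eventually[rotated])
  have "\<forall>\<^sub>F x in F. \<forall>p. c + \<eta> \<le> p \<and> p < 1 \<longrightarrow> beta_density (a x) (b x) p < \<epsilon>"
    using assms c by (intro beta_density_small_above)
  moreover have "\<forall>\<^sub>F x in F. \<forall>p. (1 - c) + \<eta> \<le> p \<and> p < 1 \<longrightarrow> beta_density (b x) (a x) p < \<epsilon>"
    using assms c lim' by (intro beta_density_small_above) (auto simp: add.commute conj_commute)
  ultimately show ?thesis
  proof eventually_elim
    case (elim x)
    show ?case
    proof safe
      fix p assume p: "p \<in> {0<..<1}" "\<eta> \<le> \<bar>c - p\<bar>"
      show "beta_density (a x) (b x) p < \<epsilon>"
      proof (cases "c + \<eta> \<le> p")
        case False
        then have "beta_density (b x) (a x) (1 - p) < \<epsilon>"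
          using p elim(2) by (auto simp: abs_if split: if_splits)
        then show ?thesis
          by (simp add: beta_density_reflect)
      qed (use elim p in auto)
    qed
  qed
qed

section \<open>Quantiles and composition of distribution functions\<close>

text \<open>The Galois connection between a cdf and its quantile function. It turns statements about
  quantiles into statements about cdfs.\<close>
lemma quantile_le_iff:
  assumes "real_distribution D" "0 < u" "u < 1"
  shows "quantile (cdf D) u \<le> x \<longleftrightarrow> u \<le> cdf D x"
proof -
  interpret cdf_distribution D
    using assms by (simp add: cdf_distribution_def)
  show ?thesis
    using pseudoinverse[of u x] assms by (simp add: quantile_def)
qed

lemma borel_measurable_quantile:
  assumes "real_distribution D"
  shows "(\<lambda>u. indicator {0<..<1} u * quantile (cdf D) u) \<in> borel_measurable borel"
proof -
  interpret cdf_distribution D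
    using assms by (simp add: cdf_distribution_def)
  show ?thesis
    using measurable_CI by (simp add: borel_measurable_restrict_space_iff quantile_def[abs_def])
qed

lemma distr_quantile:
  assumes "real_distribution D"
  shows "distr (restrict_space lborel {0<..<1}) borel (quantile (cdf D)) = D"
    and "quantile (cdf D) \<in> restrict_space lborel {0<..<1} \<rightarrow>\<^sub>M borel"
proof -
  interpret cdf_distribution D
    using assms by (simp add: cdf_distribution_def)
  show "distr (restrict_space lborel {0<..<1}) borel (quantile (cdf D)) = D"
    using distr_I_eq_M by (simp add: quantile_def[abs_def])
  show "quantile (cdf D) \<in> restrict_space lborel {0<..<1} \<rightarrow>\<^sub>M borel"
    using measurable_CI unfolding quantile_def[abs_def]
    by (subst measurable_cong_sets[OF sets_restrict_space_cong[OF sets_lborel] refl])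
qed

lemma nn_integral_quantile:
  assumes D: "real_distribution D" and [measurable]: "k \<in> borel_measurable borel"
  shows "(\<integral>\<^sup>+u\<in>{0<..<1}. k (quantile (cdf D) u) \<partial>lborel) = (\<integral>\<^sup>+x. k x \<partial>D)"
proof -
  note distr_quantile(2)[OF D, measurable]
  have "(\<integral>\<^sup>+x. k x \<partial>D) = (\<integral>\<^sup>+x. k x \<partial>distr (restrict_space lborel {0<..<1}) borel (quantile (cdf D)))"
    by (simp only: distr_quantile(1)[OF D])
  also have "\<dots> = (\<integral>\<^sup>+u. k (quantile (cdf D) u) \<partial>restrict_space lborel {0<..<1})"
    by (rule nn_integral_distr) measurable
  also have "\<dots> = (\<integral>\<^sup>+u\<in>{0<..<1}. k (quantile (cdf D) u) \<partial>lborel)"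
    by (rule nn_integral_restrict_space) auto
  finally show ?thesis ..
qed

lemma AE_quantile:
  assumes D: "real_distribution D" and AE: "AE x in D. P x"
  shows "AE u in lborel. u \<in> {0<..<1} \<longrightarrow> P (quantile (cdf D) u)"
proof -
  have "AE x in distr (restrict_space lborel {0<..<1}) borel (quantile (cdf D)). P x"
    unfolding distr_quantile(1)[OF D] by (rule AE)
  from AE_distrD[OF distr_quantile(2)[OF D] this]
  have "AE u in restrict_space lborel {0<..<1}. P (quantile (cdf D) u)" .
  then show ?thesis
    by (simp add: AE_restrict_space_iff)
qed

text \<open>Immediate from the Galois connection. The inner quantile must be a proper level, since the
  outer quantile has no meaning at 0 and 1.\<close>
lemma quantile_composed_cdf:
  assumes D: "real_distribution D" and D': "real_distribution D'" and \<nu>: "real_distribution \<nu>"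
    and comp: "\<And>x. cdf D' x = cdf \<nu> (cdf D x)"
    and u: "0 < u" "u < 1" and p: "quantile (cdf \<nu>) u \<in> {0<..<1}"
  shows "quantile (cdf D') u = quantile (cdf D) (quantile (cdf \<nu>) u)"
proof -
  have "quantile (cdf D') u \<le> x \<longleftrightarrow> quantile (cdf D) (quantile (cdf \<nu>) u) \<le> x" for x
    using p by (simp add: quantile_le_iff D D' u comp quantile_le_iff[OF \<nu> u, symmetric])
  then show ?thesis
    by (meson order.antisym order.refl)
qed

text \<open>The common integrand of both orders: it vanishes outside the set of levels at which the
  quantile of \<open>D\<close> exceeds that of \<open>E\<close>.\<close>
definition quantile_excess :: "real measure \<Rightarrow> real measure \<Rightarrow> real \<Rightarrow> real" where
  "quantile_excess D E p =
     indicator {0<..<1} p * max 0 (quantile (cdf D) p - quantile (cdf E) p)"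

lemma quantile_excess_nonneg: "0 \<le> quantile_excess D E p"
  by (simp add: quantile_excess_def)

lemma borel_measurable_quantile_excess:
  assumes "real_distribution D" "real_distribution E"
  shows "quantile_excess D E \<in> borel_measurable borel"
proof -
  have "quantile_excess D E = (\<lambda>p. max 0 (indicator {0<..<1} p * quantile (cdf D) p
      - indicator {0<..<1} p * quantile (cdf E) p))"
    by (auto simp: quantile_excess_def indicator_def)
  also have "\<dots> \<in> borel_measurable borel"
    by (intro borel_measurable_max borel_measurable_diff borel_measurable_const
        borel_measurable_quantile assms)
  finally show ?thesis .
qed

text \<open>The excess is at most \<open>\<bar>x\<bar> + \<bar>y\<bar>\<close>, and its square at most \<open>2 (x\<^sup>2 + y\<^sup>2)\<close>, where \<open>x\<close> and \<open>y\<close> are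
  the two quantiles; integrated over all levels, quantiles give back the moments.\<close>
lemma nn_integral_quantile_excess:
  assumes D: "real_distribution D" and E: "real_distribution E"
  shows "(\<integral>\<^sup>+p. ennreal (quantile_excess D E p) \<partial>lborel)
      \<le> (\<integral>\<^sup>+x. ennreal \<bar>x\<bar> \<partial>D) + (\<integral>\<^sup>+x. ennreal \<bar>x\<bar> \<partial>E)" (is ?abs)
    and "(\<integral>\<^sup>+p. ennreal ((quantile_excess D E p)\<^sup>2) \<partial>lborel)
      \<le> 2 * ((\<integral>\<^sup>+x. ennreal (x\<^sup>2) \<partial>D) + (\<integral>\<^sup>+x. ennreal (x\<^sup>2) \<partial>E))" (is ?sq)
proof -
  \<comment> \<open>The quantile function is monotone, hence measurable, only on the unit interval; its values
    elsewhere are arbitrary and are removed before it is composed with \<open>f\<close>.\<close>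
  have meas: "(\<lambda>p. ennreal (f (quantile (cdf D) p)) * indicator {0<..<1} p) \<in> borel_measurable borel"
    if "real_distribution D" and [measurable]: "f \<in> borel_measurable borel"
    for D and f :: "real \<Rightarrow> real"
  proof -
    note [measurable] = borel_measurable_quantile[OF that(1)]
    have "(\<lambda>p. ennreal (f (indicator {0<..<1} p * quantile (cdf D) p)) * indicator {0<..<1} p)
        \<in> borel_measurable borel"
      by measurable
    also have "(\<lambda>p. ennreal (f (indicator {0<..<1} p * quantile (cdf D) p)) * indicator {0<..<1} p)
        = (\<lambda>p. ennreal (f (quantile (cdf D) p)) * indicator {0<..<1::real} p)"
      by (auto simp: indicator_def)
    finally show ?thesis .
  qed
  have "(\<integral>\<^sup>+p. ennreal (quantile_excess D E p) \<partial>lborel)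
      \<le> (\<integral>\<^sup>+p. ennreal \<bar>quantile (cdf D) p\<bar> * indicator {0<..<1} p
          + ennreal \<bar>quantile (cdf E) p\<bar> * indicator {0<..<1} p \<partial>lborel)"
    by (intro nn_integral_mono)
       (auto simp: quantile_excess_def indicator_def max_def simp flip: ennreal_plus intro!: ennreal_leI)
  also have "\<dots> = (\<integral>\<^sup>+p\<in>{0<..<1}. ennreal \<bar>quantile (cdf D) p\<bar> \<partial>lborel)
      + (\<integral>\<^sup>+p\<in>{0<..<1}. ennreal \<bar>quantile (cdf E) p\<bar> \<partial>lborel)"
    using meas[OF D, of abs] meas[OF E, of abs] by (intro nn_integral_add) simp_all
  also have "\<dots> = (\<integral>\<^sup>+x. ennreal \<bar>x\<bar> \<partial>D) + (\<integral>\<^sup>+x. ennreal \<bar>x\<bar> \<partial>E)"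
    by (simp add: nn_integral_quantile[where k = "\<lambda>x. ennreal \<bar>x\<bar>"] D E)
  finally show ?abs .
  have sq: "(max 0 (x - y))\<^sup>2 \<le> 2 * (x\<^sup>2 + y\<^sup>2)" for x y :: real
  proof -
    have "0 \<le> (x + y)\<^sup>2"
      by simp
    then show ?thesis
      by (auto simp: max_def power2_eq_square algebra_simps)
  qed
  have "(\<integral>\<^sup>+p. ennreal ((quantile_excess D E p)\<^sup>2) \<partial>lborel)
      \<le> (\<integral>\<^sup>+p. 2 * (ennreal ((quantile (cdf D) p)\<^sup>2) * indicator {0<..<1} p
          + ennreal ((quantile (cdf E) p)\<^sup>2) * indicator {0<..<1} p) \<partial>lborel)"
  proof (intro nn_integral_mono)
    fix p
    show "ennreal ((quantile_excess D E p)\<^sup>2)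
        \<le> 2 * (ennreal ((quantile (cdf D) p)\<^sup>2) * indicator {0<..<1} p
          + ennreal ((quantile (cdf E) p)\<^sup>2) * indicator {0<..<1} p)"
    proof (cases "p \<in> {0<..<1}")
      case True
      have "ennreal ((quantile_excess D E p)\<^sup>2)
          \<le> ennreal (2 * ((quantile (cdf D) p)\<^sup>2 + (quantile (cdf E) p)\<^sup>2))"
        using True sq by (intro ennreal_leI) (simp add: quantile_excess_def)
      also have "\<dots> = 2 * (ennreal ((quantile (cdf D) p)\<^sup>2) + ennreal ((quantile (cdf E) p)\<^sup>2))"
        by (simp add: ennreal_mult)
      finally show ?thesis
        using True by simp
    qed (simp add: quantile_excess_def)
  qed
  also have "\<dots> = 2 * ((\<integral>\<^sup>+p\<in>{0<..<1}. ennreal ((quantile (cdf D) p)\<^sup>2) \<partial>lborel)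
      + (\<integral>\<^sup>+p\<in>{0<..<1}. ennreal ((quantile (cdf E) p)\<^sup>2) \<partial>lborel))"
    using meas[OF D, of "\<lambda>x. x\<^sup>2"] meas[OF E, of "\<lambda>x. x\<^sup>2"]
    by (simp add: nn_integral_cmult nn_integral_add)
  also have "\<dots> = 2 * ((\<integral>\<^sup>+x. ennreal (x\<^sup>2) \<partial>D) + (\<integral>\<^sup>+x. ennreal (x\<^sup>2) \<partial>E))"
    by (simp add: nn_integral_quantile[where k = "\<lambda>x. ennreal (x\<^sup>2)"] D E)
  finally show ?sq .
qed

text \<open>The substitution \<open>p = H\<^sup>-\<^sup>1(u)\<close>, where \<open>H\<close> is the cdf of \<open>\<nu>\<close>: it turns the uniform distribution
  of \<open>u\<close> into \<open>\<nu>\<close>. The levels \<open>u\<close> with \<open>p\<close> outside the open unit interval form a null set.\<close>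
lemma W2_excess_composed_le:
  assumes D: "real_distribution D" and D': "real_distribution D'"
    and E: "real_distribution E" and E': "real_distribution E'"
    and \<nu>: "real_distribution \<nu>" and \<nu>01: "AE p in \<nu>. p \<in> {0<..<1}"
    and DD': "\<And>x. cdf D' x = cdf \<nu> (cdf D x)" and EE': "\<And>x. cdf E' x = cdf \<nu> (cdf E x)"
  shows "(\<integral>\<^sup>+u\<in>{u \<in> {0<..<1}. quantile (cdf D') u > quantile (cdf E') u}.
      ennreal ((quantile (cdf D') u - quantile (cdf E') u)\<^sup>2) \<partial>lborel)
    \<le> (\<integral>\<^sup>+p. ennreal ((quantile_excess D E p)\<^sup>2) \<partial>\<nu>)"
proof -
  note [measurable] = borel_measurable_quantile_excess[OF D E]
  have "(\<integral>\<^sup>+u\<in>{u \<in> {0<..<1}. quantile (cdf D') u > quantile (cdf E') u}.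
      ennreal ((quantile (cdf D') u - quantile (cdf E') u)\<^sup>2) \<partial>lborel)
    \<le> (\<integral>\<^sup>+u\<in>{0<..<1}. ennreal ((quantile_excess D E (quantile (cdf \<nu>) u))\<^sup>2) \<partial>lborel)"
  proof (rule nn_integral_mono_AE)
    show "AE u in lborel. ennreal ((quantile (cdf D') u - quantile (cdf E') u)\<^sup>2)
          * indicator {u \<in> {0<..<1}. quantile (cdf D') u > quantile (cdf E') u} u
        \<le> ennreal ((quantile_excess D E (quantile (cdf \<nu>) u))\<^sup>2) * indicator {0<..<1} u"
      using AE_quantile[OF \<nu> \<nu>01]
    proof eventually_elim
      case (elim u)
      show ?case
      proof (cases "u \<in> {0<..<1}")
        case True
        with elim have p: "quantile (cdf \<nu>) u \<in> {0<..<1}"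
          by simp
        have "quantile (cdf D') u = quantile (cdf D) (quantile (cdf \<nu>) u)"
          "quantile (cdf E') u = quantile (cdf E) (quantile (cdf \<nu>) u)"
          using True p by (auto intro: quantile_composed_cdf D D' E E' \<nu> DD' EE')
        with p show ?thesis
          by (auto simp: quantile_excess_def indicator_def)
      qed auto
    qed
  qed
  also have "\<dots> = (\<integral>\<^sup>+p. ennreal ((quantile_excess D E p)\<^sup>2) \<partial>\<nu>)"
    by (rule nn_integral_quantile[OF \<nu>]) measurable
  finally show ?thesis .
qed

text \<open>The region \<open>S\<close> between the graphs of the two cdfs is measured in two ways. Its sections at
  fixed \<open>x\<close> are intervals of levels, whose \<open>\<nu>\<close>-measures are the differences of the composed cdfs;
  its sections at a fixed level are the intervals between the two quantiles.\<close>
lemma L1_excess_composed_le: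
  assumes D: "real_distribution D" and E: "real_distribution E"
    and \<nu>: "real_distribution \<nu>" and \<nu>01: "AE p in \<nu>. p \<in> {0<..<1}"
  shows "(\<integral>\<^sup>+x\<in>{x. cdf \<nu> (cdf D x) < cdf \<nu> (cdf E x)}.
      ennreal \<bar>cdf \<nu> (cdf D x) - cdf \<nu> (cdf E x)\<bar> \<partial>lborel)
    \<le> (\<integral>\<^sup>+p. ennreal (quantile_excess D E p) \<partial>\<nu>)"
proof -
  interpret \<nu>: real_distribution \<nu> by (rule \<nu>)
  interpret D: cdf_distribution D using D by (simp add: cdf_distribution_def)
  interpret E: cdf_distribution E using E by (simp add: cdf_distribution_def)
  interpret pair_sigma_finite \<nu> lborel ..
  define S where "S = {(p, x). p \<in> {0<..<1} \<and> cdf D x < p \<and> p \<le> cdf E x}"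
  have [measurable]: "cdf D \<in> borel_measurable borel" "cdf E \<in> borel_measurable borel"
    by (rule D.measurable_C E.measurable_C)+
  have "{z \<in> space (borel \<Otimes>\<^sub>M borel). fst z \<in> {0<..<1} \<and> cdf D (snd z) < fst z \<and> fst z \<le> cdf E (snd z)}
      \<in> sets (borel \<Otimes>\<^sub>M borel)"
    by measurable
  then have S [measurable]: "S \<in> sets (borel \<Otimes>\<^sub>M borel)"
    by (simp add: S_def case_prod_beta' space_pair_measure)
  have "(\<integral>\<^sup>+x\<in>{x. cdf \<nu> (cdf D x) < cdf \<nu> (cdf E x)}.
      ennreal \<bar>cdf \<nu> (cdf D x) - cdf \<nu> (cdf E x)\<bar> \<partial>lborel)
    \<le> (\<integral>\<^sup>+x. (\<integral>\<^sup>+p. indicator S (p, x) \<partial>\<nu>) \<partial>lborel)"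
  proof (rule nn_integral_mono)
    fix x
    show "ennreal \<bar>cdf \<nu> (cdf D x) - cdf \<nu> (cdf E x)\<bar>
        * indicator {x. cdf \<nu> (cdf D x) < cdf \<nu> (cdf E x)} x \<le> (\<integral>\<^sup>+p. indicator S (p, x) \<partial>\<nu>)"
    proof (cases "cdf \<nu> (cdf D x) < cdf \<nu> (cdf E x)")
      case True
      then have "cdf D x \<le> cdf E x"
        using \<nu>.cdf_nondecreasing[of "cdf E x" "cdf D x"] by linarith
      then have "ennreal \<bar>cdf \<nu> (cdf D x) - cdf \<nu> (cdf E x)\<bar> = emeasure \<nu> {cdf D x<..cdf E x}"
        using True by (simp add: \<nu>.emeasure_Ioc)
      also have "\<dots> = (\<integral>\<^sup>+p. indicator {cdf D x<..cdf E x} p \<partial>\<nu>)"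
        by simp
      also have "\<dots> = (\<integral>\<^sup>+p. indicator S (p, x) \<partial>\<nu>)"
        using \<nu>01 by (intro nn_integral_cong_AE) (auto simp: S_def indicator_def)
      finally show ?thesis
        using True by simp
    qed simp
  qed
  also have "\<dots> = (\<integral>\<^sup>+p. (\<integral>\<^sup>+x. indicator S (p, x) \<partial>lborel) \<partial>\<nu>)"
    by (rule Fubini') measurable
  also have "\<dots> = (\<integral>\<^sup>+p. ennreal (quantile_excess D E p) \<partial>\<nu>)"
  proof (rule nn_integral_cong)
    fix p
    show "(\<integral>\<^sup>+x. indicator S (p, x) \<partial>lborel) = ennreal (quantile_excess D E p)"
    proof (cases "p \<in> {0<..<1}")
      case True
      have "indicator S (p, x) = (indicator {quantile (cdf E) p..<quantile (cdf D) p} x :: ennreal)" for x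
        using True quantile_le_iff[OF D, of p x] quantile_le_iff[OF E, of p x]
        by (auto simp: S_def indicator_def)
      then show ?thesis
        using True by (simp add: quantile_excess_def max_def)
    next
      case False
      then have "indicator S (p, x) = (0 :: ennreal)" for x
        by (auto simp: S_def indicator_def)
      with False show ?thesis
        by (simp add: quantile_excess_def)
    qed
  qed
  finally show ?thesis .
qed

section \<open>Mixtures of Beta distributions\<close>

definition beta_mixture ::
  "nat \<Rightarrow> (nat \<Rightarrow> real) \<Rightarrow> (nat \<Rightarrow> real) \<Rightarrow> (nat \<Rightarrow> real) \<Rightarrow> real measure" where
  "beta_mixture s w a b =
     density lborel (\<lambda>v. ennreal (\<Sum>i=1..s. w i * beta_density (a i) (b i) v))"

context
  fixes s :: nat and w a b :: "nat \<Rightarrow> real"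
  assumes ab: "\<And>i. i \<in> {1..s} \<Longrightarrow> 0 < a i" "\<And>i. i \<in> {1..s} \<Longrightarrow> 0 < b i"
    and w: "\<And>i. i \<in> {1..s} \<Longrightarrow> 0 < w i" "(\<Sum>i=1..s. w i) = 1"
begin

lemma beta_mixture_density_nonneg: "0 \<le> (\<Sum>i=1..s. w i * beta_density (a i) (b i) v)"
  using ab w by (intro sum_nonneg mult_nonneg_nonneg beta_density_nonneg) (auto intro: less_imp_le)

lemma has_bochner_integral_beta_mixture_density:
  "has_bochner_integral lborel (\<lambda>v. \<Sum>i=1..s. w i * beta_density (a i) (b i) v) 1"
proof -
  have "has_bochner_integral lborel (\<lambda>v. \<Sum>i=1..s. w i * beta_density (a i) (b i) v) (\<Sum>i=1..s. w i * 1)"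
    using ab by (intro has_bochner_integral_sum has_bochner_integral_mult_right
        has_bochner_integral_beta_density)
  then show ?thesis
    using w by simp
qed

lemma real_distribution_beta_mixture: "real_distribution (beta_mixture s w a b)"
proof -
  have "emeasure (beta_mixture s w a b) UNIV
      = (\<integral>\<^sup>+v. ennreal (\<Sum>i=1..s. w i * beta_density (a i) (b i) v) \<partial>lborel)"
    by (simp add: beta_mixture_def emeasure_density)
  also have "\<dots> = 1"
    using has_bochner_integral_beta_mixture_density beta_mixture_density_nonneg
    by (subst nn_integral_eq_integral) (auto simp: has_bochner_integral_iff)
  finally have "prob_space (beta_mixture s w a b)"
    by (intro prob_spaceI) (simp add: beta_mixture_def)
  then show ?thesis
    by (simp add: real_distribution_def real_distribution_axioms_def beta_mixture_def)
qed

lemma AE_beta_mixture: "AE p in beta_mixture s w a b. p \<in> {0<..<1}"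
proof -
  have "p \<in> {0<..<1}" if "0 < (\<Sum>i=1..s. w i * beta_density (a i) (b i) p)" for p
  proof (rule ccontr)
    assume "p \<notin> {0<..<1}"
    then have "(\<Sum>i=1..s. w i * beta_density (a i) (b i) p) = 0"
      by (intro sum.neutral) (simp add: beta_density_def)
    with that show False
      by simp
  qed
  then show ?thesis
    unfolding beta_mixture_def by (subst AE_density) (auto simp del: greaterThanLessThan_iff)
qed

text \<open>The bound \<open>u \<le> 1\<close> is essential: beyond 1 the integral in \<open>beta_phi\<close> runs over points where
  the Beta density vanishes but its integrand does not.\<close>
lemma cdf_beta_mixture:
  assumes "u \<le> 1"
  shows "cdf (beta_mixture s w a b) u = (\<Sum>i=1..s. w i * beta_phi (a i) (a i + b i - 1) u)"
proof -
  let ?h = "\<lambda>v. \<Sum>i=1..s. w i * beta_density (a i) (b i) v"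
  have int: "integrable lborel (\<lambda>v. indicator {..u} v * beta_density (a i) (b i) v)"
    if "i \<in> {1..s}" for i
    using has_bochner_integral_beta_density[OF ab[OF that]]
      integrable_mult_indicator[of "{..u}" lborel "beta_density (a i) (b i)"]
    by (simp add: has_bochner_integral_iff)
  have phi: "(LINT v|lborel. indicator {..u} v * beta_density (a i) (b i) v)
      = beta_phi (a i) (a i + b i - 1) u" for i
  proof -
    have "indicator {..u} v * beta_density (a i) (b i) v =
        1 / Beta (a i) (b i) * (indicator {0..u} v *\<^sub>R (v powr (a i - 1) * (1 - v) powr (b i - 1)))" for v
      using assms by (auto simp: beta_density_def indicator_def)
    then show ?thesis
      by (simp add: beta_phi_def set_lebesgue_integral_def)
  qed
  have eq: "indicator {..u} v * ?h v =
      (\<Sum>i=1..s. w i * (indicator {..u} v * beta_density (a i) (b i) v))" for v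
    by (simp add: sum_distrib_left mult_ac)
  have hint: "integrable lborel (\<lambda>v. indicator {..u} v * ?h v)"
    unfolding eq using int by (intro Bochner_Integration.integrable_sum integrable_mult_right)
  have "emeasure (beta_mixture s w a b) {..u} = (\<integral>\<^sup>+v. ennreal (?h v) * indicator {..u} v \<partial>lborel)"
    by (simp add: beta_mixture_def emeasure_density)
  also have "\<dots> = (\<integral>\<^sup>+v. ennreal (indicator {..u} v * ?h v) \<partial>lborel)"
    by (intro nn_integral_cong) (auto simp: indicator_def)
  also have "\<dots> = ennreal (LINT v|lborel. indicator {..u} v * ?h v)"
    using hint beta_mixture_density_nonneg by (intro nn_integral_eq_integral) auto
  finally have "cdf (beta_mixture s w a b) u = (LINT v|lborel. indicator {..u} v * ?h v)"
    using beta_mixture_density_nonneg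
    by (simp add: cdf_def measure_def integral_nonneg)
  also have "\<dots> = (\<Sum>i=1..s. w i * (LINT v|lborel. indicator {..u} v * beta_density (a i) (b i) v))"
    unfolding eq using int by (subst Bochner_Integration.integral_sum) auto
  finally show ?thesis
    by (simp add: phi)
qed

text \<open>The weights sum to 1, so a bound for all components on the support of \<open>k\<close> bounds the mixture.\<close>
lemma nn_integral_beta_mixture_le:
  assumes [measurable]: "k \<in> borel_measurable borel"
    and small: "\<And>i p. i \<in> {1..s} \<Longrightarrow> k p \<noteq> 0 \<Longrightarrow> beta_density (a i) (b i) p \<le> \<epsilon>"
  shows "(\<integral>\<^sup>+p. k p \<partial>beta_mixture s w a b) \<le> ennreal \<epsilon> * (\<integral>\<^sup>+p. k p \<partial>lborel)"
proof -
  have "(\<integral>\<^sup>+p. k p \<partial>beta_mixture s w a b)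
      = (\<integral>\<^sup>+p. ennreal (\<Sum>i=1..s. w i * beta_density (a i) (b i) p) * k p \<partial>lborel)"
    unfolding beta_mixture_def by (rule nn_integral_density) auto
  also have "\<dots> \<le> (\<integral>\<^sup>+p. ennreal \<epsilon> * k p \<partial>lborel)"
  proof (rule nn_integral_mono)
    fix p
    show "ennreal (\<Sum>i=1..s. w i * beta_density (a i) (b i) p) * k p \<le> ennreal \<epsilon> * k p"
    proof (cases "k p = 0")
      case False
      have "(\<Sum>i=1..s. w i * beta_density (a i) (b i) p) \<le> (\<Sum>i=1..s. w i * \<epsilon>)"
        using small False w by (intro sum_mono mult_left_mono) (auto intro: less_imp_le)
      also have "\<dots> = \<epsilon>"
        using w by (simp flip: sum_distrib_right)
      finally show ?thesis
        by (intro mult_right_mono ennreal_leI) auto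
    qed simp
  qed
  also have "\<dots> = ennreal \<epsilon> * (\<integral>\<^sup>+p. k p \<partial>lborel)"
    by (rule nn_integral_cmult) simp
  finally show ?thesis .
qed

end

section \<open>The asymptotic stochastic orders\<close>

lemma ennreal_tendsto_0_of_eventually_le:
  fixes f :: "'a \<Rightarrow> ennreal"
  assumes "C < \<infinity>" and le: "\<And>\<epsilon>. 0 < \<epsilon> \<Longrightarrow> \<forall>\<^sub>F x in F. f x \<le> ennreal \<epsilon> * C"
  shows "(f \<longlongrightarrow> 0) F"
proof (rule order_tendstoI)
  fix y :: ennreal assume "0 < y"
  then obtain z where z: "0 < z" "z < y"
    using dense by blast
  obtain c where c: "C = ennreal c" "0 \<le> c"
    using \<open>C < \<infinity>\<close> by (cases C) auto
  obtain d where d: "z = ennreal d" "0 < d"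
    using z by (cases z) (auto simp: less_top[symmetric])
  have "ennreal (d / (c + 1)) * C = ennreal (d * (c / (c + 1)))"
    using c d by (simp add: ennreal_mult[symmetric])
  also have "\<dots> \<le> ennreal d"
    using c d by (intro ennreal_leI mult_left_le) auto
  finally have "ennreal (d / (c + 1)) * C < y"
    using z d by simp
  moreover have "\<forall>\<^sub>F x in F. f x \<le> ennreal (d / (c + 1)) * C"
    using c d by (intro le) auto
  ultimately show "\<forall>\<^sub>F x in F. f x < y"
    by (auto elim: eventually_mono)
qed auto

theorem theorem7p8:
  fixes M :: "'a measure" and X :: "'a \<Rightarrow> real"
    and N :: "'b measure" and Y :: "'b \<Rightarrow> real"
    and P :: "real \<Rightarrow> 'c measure" and Xw :: "real \<Rightarrow> 'c \<Rightarrow> real"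
    and Q :: "real \<Rightarrow> 'd measure" and Yw :: "real \<Rightarrow> 'd \<Rightarrow> real"
    and s :: nat and w :: "nat \<Rightarrow> real" and r :: "nat \<Rightarrow> real \<Rightarrow> real"
    and lam :: "nat \<Rightarrow> real" and A0 :: "real set"
  assumes X: "prob_space M" "X \<in> borel_measurable M"
    and Y: "prob_space N" "Y \<in> borel_measurable N"
    and A0: "A0 = {u\<in>{0<..<1}. quantile (rv_cdf M X) u > quantile (rv_cdf N Y) u}"
    and s: "1 \<le> s"
    and w_pos: "\<And>i. i \<in> {1..s} \<Longrightarrow> 0 < w i"
    and w_sum: "(\<Sum>i=1..s. w i) = 1"
    and r_pos: "\<And>\<alpha>. 0 < \<alpha> \<Longrightarrow> 0 < r 1 \<alpha>"
    and r_mono: "\<And>\<alpha>. 0 < \<alpha> \<Longrightarrow> strict_mono_on {1..s} (\<lambda>i. r i \<alpha>)"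
    and r_less: "\<And>\<alpha>. 0 < \<alpha> \<Longrightarrow> r s \<alpha> < \<alpha> + 1"
    and lam: "\<And>i. i \<in> {1..s} \<Longrightarrow> ((\<lambda>\<alpha>. r i \<alpha> / (\<alpha> + 1)) \<longlongrightarrow> lam i) at_top"
    and lam_mono: "strict_mono_on {1..s} lam"
    and Xw: "\<And>\<alpha>. 0 < \<alpha> \<Longrightarrow> prob_space (P \<alpha>)"
      "\<And>\<alpha>. 0 < \<alpha> \<Longrightarrow> Xw \<alpha> \<in> borel_measurable (P \<alpha>)"
      "\<And>\<alpha> x. 0 < \<alpha> \<Longrightarrow> rv_cdf (P \<alpha>) (Xw \<alpha>) x = (\<Sum>i=1..s. w i * beta_phi (r i \<alpha>) \<alpha> (rv_cdf M X x))"
    and Yw: "\<And>\<alpha>. 0 < \<alpha> \<Longrightarrow> prob_space (Q \<alpha>)"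
      "\<And>\<alpha>. 0 < \<alpha> \<Longrightarrow> Yw \<alpha> \<in> borel_measurable (Q \<alpha>)"
      "\<And>\<alpha> x. 0 < \<alpha> \<Longrightarrow> rv_cdf (Q \<alpha>) (Yw \<alpha>) x = (\<Sum>i=1..s. w i * beta_phi (r i \<alpha>) \<alpha> (rv_cdf N Y x))"
    and dist_pos: "(MIN i\<in>{1..s}. ereal_dist (lam i) A0) > 0"
  shows "(max (\<integral>\<^sup>+\<omega>. ennreal \<bar>X \<omega>\<bar> \<partial>M) (\<integral>\<^sup>+\<omega>. ennreal \<bar>Y \<omega>\<bar> \<partial>N) < \<infinity> \<longrightarrow> L1_ast_le P Xw Q Yw) \<and>
         (max (\<integral>\<^sup>+\<omega>. ennreal ((X \<omega>)\<^sup>2) \<partial>M) (\<integral>\<^sup>+\<omega>. ennreal ((Y \<omega>)\<^sup>2) \<partial>N) < \<infinity> \<longrightarrow> W2_ast_le P Xw Q Yw)"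
proof -
  define D where "D = distr M borel X"
  define E where "E = distr N borel Y"
  define \<nu> where "\<nu> \<alpha> = beta_mixture s w (\<lambda>i. r i \<alpha>) (\<lambda>i. \<alpha> - r i \<alpha> + 1)" for \<alpha>
  have D: "real_distribution D" and E: "real_distribution E"
    unfolding D_def E_def using X Y by (auto intro: prob_space.real_distribution_distr)
  have D': "real_distribution (distr (P \<alpha>) borel (Xw \<alpha>))"
    and E': "real_distribution (distr (Q \<alpha>) borel (Yw \<alpha>))" if "0 < \<alpha>" for \<alpha>
    using Xw Yw that by (auto intro: prob_space.real_distribution_distr)
  note [measurable] = X(2) Y(2) borel_measurable_quantile_excess[OF D E]
  have r: "0 < r i \<alpha>" "0 < \<alpha> - r i \<alpha> + 1" if "i \<in> {1..s}" "0 < \<alpha>" for i \<alpha>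
  proof -
    have "r 1 \<alpha> \<le> r i \<alpha>" "r i \<alpha> \<le> r s \<alpha>"
      using that s by (auto intro!: strict_mono_on_leD[OF r_mono])
    then show "0 < r i \<alpha>" "0 < \<alpha> - r i \<alpha> + 1"
      using r_pos[OF that(2)] r_less[OF that(2)] by auto
  qed
  have \<nu>: "real_distribution (\<nu> \<alpha>)" "AE p in \<nu> \<alpha>. p \<in> {0<..<1}" if "0 < \<alpha>" for \<alpha>
    unfolding \<nu>_def
    by (rule real_distribution_beta_mixture AE_beta_mixture; use r w_pos w_sum that in auto)+
  have cdf_\<nu>: "cdf (\<nu> \<alpha>) u = (\<Sum>i=1..s. w i * beta_phi (r i \<alpha>) \<alpha> u)" if "0 < \<alpha>" "u \<le> 1" for \<alpha> u
    unfolding \<nu>_def using that r w_pos w_sum by (subst cdf_beta_mixture) auto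
  have DD': "cdf (distr (P \<alpha>) borel (Xw \<alpha>)) x = cdf (\<nu> \<alpha>) (cdf D x)"
    and EE': "cdf (distr (Q \<alpha>) borel (Yw \<alpha>)) x = cdf (\<nu> \<alpha>) (cdf E x)" if "0 < \<alpha>" for \<alpha> x
    using Xw(3)[OF that, of x] Yw(3)[OF that, of x] that
      real_distribution.cdf_bounded_prob[OF D] real_distribution.cdf_bounded_prob[OF E]
    by (simp_all add: rv_cdf_def D_def E_def cdf_\<nu>)

  \<comment> \<open>The distances are infinite if \<open>A0\<close> is empty, so \<open>\<eta>\<close> is taken strictly below their minimum.\<close>
  obtain \<eta> where \<eta>: "0 < \<eta>" "\<And>i p. i \<in> {1..s} \<Longrightarrow> p \<in> A0 \<Longrightarrow> \<eta> \<le> \<bar>lam i - p\<bar>"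
  proof -
    obtain \<eta> where "0 < ereal \<eta>" and \<eta>: "ereal \<eta> < (MIN i\<in>{1..s}. ereal_dist (lam i) A0)"
      using dist_pos by (metis ereal_dense2 zero_ereal_def)
    moreover have "\<eta> \<le> \<bar>lam i - p\<bar>" if "i \<in> {1..s}" "p \<in> A0" for i p
    proof -
      have "ereal \<eta> < ereal_dist (lam i) A0"
        using \<eta> that by (subst (asm) Min_gr_iff) auto
      also have "\<dots> \<le> ereal \<bar>lam i - p\<bar>"
        unfolding ereal_dist_def using that by (intro INF_lower)
      finally show ?thesis
        by simp
    qed
    ultimately show ?thesis
      using that by auto
  qed

  have small: "\<forall>\<^sub>F \<alpha> in at_top. \<forall>i\<in>{1..s}. \<forall>p\<in>A0. beta_density (r i \<alpha>) (\<alpha> - r i \<alpha> + 1) p < \<epsilon>"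
    if "0 < \<epsilon>" for \<epsilon>
  proof (rule eventually_ball_finite[OF finite_atLeastAtMost], rule ballI)
    fix i assume i: "i \<in> {1..s}"
    have "\<forall>\<^sub>F \<alpha> in at_top. \<forall>p\<in>{0<..<1}. \<eta> \<le> \<bar>lam i - p\<bar>
        \<longrightarrow> beta_density (r i \<alpha>) (\<alpha> - r i \<alpha> + 1) p < \<epsilon>"
    proof (rule beta_density_small_away)
      show "\<forall>\<^sub>F \<alpha> in at_top. 0 < r i \<alpha> \<and> 0 < \<alpha> - r i \<alpha> + 1"
        using eventually_gt_at_top[of 0] by eventually_elim (use r i in auto)
      show "filterlim (\<lambda>\<alpha>. r i \<alpha> + (\<alpha> - r i \<alpha> + 1)) at_top at_top"
        using filterlim_tendsto_add_at_top[OF tendsto_const[of 1] filterlim_ident]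
        by (simp add: add.commute)
    qed (use lam i \<eta> that in \<open>auto simp: add.commute\<close>)
    then show "\<forall>\<^sub>F \<alpha> in at_top. \<forall>p\<in>A0. beta_density (r i \<alpha>) (\<alpha> - r i \<alpha> + 1) p < \<epsilon>"
      by eventually_elim (use \<eta> i A0 in auto)
  qed

  have excess_A0: "p \<in> A0" if "quantile_excess D E p \<noteq> 0" for p
    using that unfolding A0 quantile_excess_def D_def E_def rv_cdf_def
    by (auto simp: indicator_def max_def split: if_splits)
  \<comment> \<open>The step common to both orders, used with \<open>g\<close> the identity and the square.\<close>
  have limit: "(I \<longlongrightarrow> 0) at_top"
    if I: "\<And>\<alpha>. 0 < \<alpha> \<Longrightarrow> I \<alpha> \<le> (\<integral>\<^sup>+p. ennreal (g (quantile_excess D E p)) \<partial>\<nu> \<alpha>)"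
      and fin: "(\<integral>\<^sup>+p. ennreal (g (quantile_excess D E p)) \<partial>lborel) < \<infinity>"
      and [measurable]: "g \<in> borel_measurable borel" and "g 0 = 0"
    for I :: "real \<Rightarrow> ennreal" and g :: "real \<Rightarrow> real"
  proof (rule ennreal_tendsto_0_of_eventually_le[OF fin])
    fix \<epsilon> :: real assume "0 < \<epsilon>"
    from small[OF this] eventually_gt_at_top[of 0]
    show "\<forall>\<^sub>F \<alpha> in at_top. I \<alpha> \<le> ennreal \<epsilon> * (\<integral>\<^sup>+p. ennreal (g (quantile_excess D E p)) \<partial>lborel)"
    proof eventually_elim
      case (elim \<alpha>)
      have "(\<integral>\<^sup>+p. ennreal (g (quantile_excess D E p)) \<partial>\<nu> \<alpha>)
          \<le> ennreal \<epsilon> * (\<integral>\<^sup>+p. ennreal (g (quantile_excess D E p)) \<partial>lborel)"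
        unfolding \<nu>_def
      proof (rule nn_integral_beta_mixture_le)
        fix i p assume "i \<in> {1..s}" "ennreal (g (quantile_excess D E p)) \<noteq> 0"
        with \<open>g 0 = 0\<close> have "p \<in> A0"
          by (intro excess_A0) auto
        with elim \<open>i \<in> {1..s}\<close> show "beta_density (r i \<alpha>) (\<alpha> - r i \<alpha> + 1) p \<le> \<epsilon>"
          by (auto intro: less_imp_le)
      qed (use r w_pos w_sum elim in auto)
      with I[of \<alpha>] elim show ?case
        by (auto intro: order_trans)
    qed
  qed

  show ?thesis
  proof (intro conjI impI)
    assume "max (\<integral>\<^sup>+\<omega>. ennreal \<bar>X \<omega>\<bar> \<partial>M) (\<integral>\<^sup>+\<omega>. ennreal \<bar>Y \<omega>\<bar> \<partial>N) < \<infinity>"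
    then have "(\<integral>\<^sup>+x. ennreal \<bar>x\<bar> \<partial>D) + (\<integral>\<^sup>+x. ennreal \<bar>x\<bar> \<partial>E) < \<infinity>"
      by (simp add: D_def E_def nn_integral_distr)
    from le_less_trans[OF nn_integral_quantile_excess(1)[OF D E] this]
    show "L1_ast_le P Xw Q Yw"
      unfolding L1_ast_le_def
      by (intro limit[where g = "\<lambda>x. x"])
         (simp_all add: rv_cdf_def DD' EE' L1_excess_composed_le[OF D E \<nu>])
  next
    assume "max (\<integral>\<^sup>+\<omega>. ennreal ((X \<omega>)\<^sup>2) \<partial>M) (\<integral>\<^sup>+\<omega>. ennreal ((Y \<omega>)\<^sup>2) \<partial>N) < \<infinity>"
    then have "2 * ((\<integral>\<^sup>+x. ennreal (x\<^sup>2) \<partial>D) + (\<integral>\<^sup>+x. ennreal (x\<^sup>2) \<partial>E)) < \<infinity>"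
      by (simp add: D_def E_def nn_integral_distr ennreal_mult_less_top)
    from le_less_trans[OF nn_integral_quantile_excess(2)[OF D E] this]
    show "W2_ast_le P Xw Q Yw"
      unfolding W2_ast_le_def rv_cdf_def
      by (intro limit[where g = "\<lambda>x. x\<^sup>2"] W2_excess_composed_le D D' E E' \<nu> DD' EE') simp_all
  qed
qed

end
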